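(* Let $f\colon[0,\infty)\to\mathbb{R}$ be a function for which the limit $\lim_{t\to\infty}\int_0^t f(\tau)\,\mathrm{d}\tau$ exists (in $\mathbb{R}$), and suppose that $f$ is Hölder continuous of order $\alpha\in(0,1]$, i.e. there is a constant $c\geqslant 0$ such that $|f(t)-f(\tau)|\leqslant c\,|t-\tau|^{\alpha}$ for all $t,\tau\in[0,\infty)$. Then $$|f(t)|\leqslant(1+c)\,S(t)^{\alpha/(1+\alpha)}\quad\text{for all } t\geqslant 0,$$ where $S(t)=\sup_{s\geqslant t}\bigl|\int_t^s f(\tau)\,\mathrm{d}\tau\bigr|$. *)

theory Defs
  imports "HOL-Analysis.Analysis"
begin

(* The supremum is taken in the reals: it is meaningful because the set is bounded above
   whenever f is continuous on {0..}, its improper integral converges, and t \<ge> 0. *)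
definition tail_sup :: "(real \<Rightarrow> real) \<Rightarrow> real \<Rightarrow> real" where
  "tail_sup f t = (SUP s\<in>{t..}. \<bar>integral {t..s} f\<bar>)"

end

theory Submission
  imports Defs
begin

text \<open>
  On \<open>[t, t + h]\<close> the function differs from \<open>f t\<close> by at most \<open>c h\<^sup>\<alpha>\<close>, so integrating gives
  \<open>h \<bar>f t\<bar> \<le> S(t) + c h\<^bsup>1 + \<alpha>\<^esup>\<close> for every \<open>h > 0\<close>. The choice \<open>h = S(t)\<^bsup>1 / (1 + \<alpha>)\<^esup>\<close> balances
  the two terms; if \<open>S(t) = 0\<close>, let \<open>h\<close> tend to \<open>0\<close> instead.
\<close>

text \<open>Continuity is wanted because it makes \<open>f\<close> integrable on every compact
  subinterval of the half-line, so all integrals below are genuine and additive.\<close>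

lemma Holder_continuous_on:
  fixes f :: "real \<Rightarrow> real"
  assumes "0 < \<alpha>"
    and H: "\<And>x y. x \<in> A \<Longrightarrow> y \<in> A \<Longrightarrow> \<bar>f x - f y\<bar> \<le> c * \<bar>x - y\<bar> powr \<alpha>"
  shows "continuous_on A f"
  unfolding continuous_on_def
proof
  fix x assume x: "x \<in> A"
  have "((\<lambda>y. \<bar>y - x\<bar>) \<longlongrightarrow> 0) (at x within A)"
    by (auto intro!: tendsto_eq_intros)
  \<comment> \<open>The base tends to 0, so passing to the limit relies on the exponent being
    positive and the base nonnegative.\<close>
  then have "((\<lambda>y. \<bar>y - x\<bar> powr \<alpha>) \<longlongrightarrow> 0 powr \<alpha>) (at x within A)"
    by (rule tendsto_powr') (use assms(1) in auto)
  then have "((\<lambda>y. c * \<bar>y - x\<bar> powr \<alpha>) \<longlongrightarrow> 0) (at x within A)"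
    using tendsto_mult_right_zero by force
  moreover have "\<forall>\<^sub>F y in at x within A. norm (f y - f x) \<le> c * \<bar>y - x\<bar> powr \<alpha>"
    using H x by (auto simp: eventually_at_filter)
  ultimately have "((\<lambda>y. f y - f x) \<longlongrightarrow> 0) (at x within A)"
    by (rule Lim_null_comparison[rotated])
  then show "(f \<longlongrightarrow> f x) (at x within A)"
    by (rule LIM_zero_cancel)
qed

text \<open>A real \<open>SUP\<close> dominates its members only if the set is bounded above. The
  tail integral is a difference of two values of the integral from 0, which is bounded near infinity
  by convergence and on the remaining compact interval by continuity.\<close>

lemma bdd_above_tail_integrals:
  fixes f :: "real \<Rightarrow> real"
  assumes lim: "((\<lambda>t. integral {0..t} f) \<longlongrightarrow> L) at_top"
    and cont: "continuous_on {0..} f" and "0 \<le> t"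
  shows "bdd_above ((\<lambda>s. \<bar>integral {t..s} f\<bar>) ` {t..})"
proof -
  have int: "f integrable_on {a..b}" if "0 \<le> a" for a b
    using that by (intro integrable_continuous_real continuous_on_subset[OF cont]) auto
  have "\<forall>\<^sub>F s in at_top. \<bar>integral {0..s} f - L\<bar> < 1"
    using tendstoD[OF lim, of 1] by (simp add: dist_real_def)
  then obtain N where N: "\<And>s. N \<le> s \<Longrightarrow> \<bar>integral {0..s} f - L\<bar> < 1"
    by (auto simp: eventually_at_top_linorder)
  have "compact ((\<lambda>s. integral {0..s} f) ` {0..N})"
    by (intro compact_continuous_image indefinite_integral_continuous_1 int) auto
  then obtain B where B: "\<And>s. 0 \<le> s \<Longrightarrow> s \<le> N \<Longrightarrow> \<bar>integral {0..s} f\<bar> \<le> B"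
    using compact_imp_bounded bounded_iff by (metis (no_types, lifting) atLeastAtMost_iff image_eqI real_norm_def)
  \<comment> \<open>\<open>B\<close> serves up to \<open>N\<close>, and
    \<open>\<bar>L\<bar> + 1\<close> beyond it.\<close>
  define M where "M = max B (\<bar>L\<bar> + 1)"
  have M: "\<bar>integral {0..s} f\<bar> \<le> M" if "0 \<le> s" for s
    using N[of s] B[of s] that unfolding M_def by (cases "s \<le> N") auto
  show ?thesis
  proof (rule bdd_aboveI2)
    fix s assume s: "s \<in> {t..}"
    have "integral {0..t} f + integral {t..s} f = integral {0..s} f"
      using s \<open>0 \<le> t\<close> by (intro Henstock_Kurzweil_Integration.integral_combine int) auto
    then show "\<bar>integral {t..s} f\<bar> \<le> 2 * M"
      using M[of t] M[of s] s \<open>0 \<le> t\<close> by auto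
  qed
qed

text \<open>Integrating the deviation from the constant \<open>f t\<close> costs at most the length
  \<open>h\<close> times its maximal size; dividing by \<open>h\<close> leaves a bound in which
  \<open>h\<close> can still be chosen.\<close>

lemma Holder_abs_le_integral:
  fixes f :: "real \<Rightarrow> real"
  assumes "0 < h" "0 \<le> \<alpha>" "0 \<le> c"
    and int: "f integrable_on {t..t + h}"
    and H: "\<And>x. x \<in> {t..t + h} \<Longrightarrow> \<bar>f x - f t\<bar> \<le> c * \<bar>x - t\<bar> powr \<alpha>"
  shows "\<bar>f t\<bar> \<le> \<bar>integral {t..t + h} f\<bar> / h + c * h powr \<alpha>"
proof -
  have bound: "norm (f x - f t) \<le> c * h powr \<alpha>" if "x \<in> cbox t (t + h)" for x
  proof -
    have "\<bar>x - t\<bar> powr \<alpha> \<le> h powr \<alpha>"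
      using that assms(2) by (intro powr_mono2) auto
    then show ?thesis
      using H[of x] that mult_left_mono[OF _ \<open>0 \<le> c\<close>] by fastforce
  qed
  have "((\<lambda>x. f x - f t) has_integral (integral {t..t + h} f - h * f t)) (cbox t (t + h))"
    using has_integral_diff[OF integrable_integral[OF int] has_integral_const_real[of "f t" t "t + h"]]
      assms(1) by simp
  then have "norm (integral {t..t + h} f - h * f t) \<le> c * h powr \<alpha> * measure lborel (cbox t (t + h))"
    by (rule has_integral_bound[rotated]) (use \<open>0 \<le> c\<close> bound in simp_all)
  then have "\<bar>integral {t..t + h} f - h * f t\<bar> \<le> h * (c * h powr \<alpha>)"
    using assms(1) by (simp add: mult_ac)
  then have "\<bar>h * f t\<bar> \<le> \<bar>integral {t..t + h} f\<bar> + h * (c * h powr \<alpha>)"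
    by arith
  then have "h * \<bar>f t\<bar> \<le> \<bar>integral {t..t + h} f\<bar> + h * (c * h powr \<alpha>)"
    using assms(1) by (simp add: abs_mult)
  then show ?thesis
    using assms(1) by (simp add: field_simps)
qed

theorem theorem8:
  fixes f :: "real \<Rightarrow> real" and \<alpha> c :: real
  assumes "\<exists>L. ((\<lambda>t. integral {0..t} f) \<longlongrightarrow> L) at_top"
    and "0 < \<alpha>" and "\<alpha> \<le> 1" and "0 \<le> c"
    and "\<And>t \<tau>. t \<ge> 0 \<Longrightarrow> \<tau> \<ge> 0 \<Longrightarrow> \<bar>f t - f \<tau>\<bar> \<le> c * \<bar>t - \<tau>\<bar> powr \<alpha>"
  shows "\<forall>t\<ge>0. \<bar>f t\<bar> \<le> (1 + c) * tail_sup f t powr (\<alpha> / (1 + \<alpha>))"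
proof (intro allI impI)
  fix t :: real assume t: "0 \<le> t"
  define S where "S = tail_sup f t"
  have cont: "continuous_on {0..} f"
    using assms(2,5) by (intro Holder_continuous_on[of \<alpha>]) auto
  have le_S: "\<bar>integral {t..s} f\<bar> \<le> S" if "t \<le> s" for s
    unfolding S_def tail_sup_def
    using assms(1) bdd_above_tail_integrals[OF _ cont t] that by (auto intro!: cSUP_upper)
  \<comment> \<open>The choice \<open>s = t\<close> gives an integral equal to 0.\<close>
  have "0 \<le> S"
    using le_S[of t] by simp
  have main: "\<bar>f t\<bar> \<le> S / h + c * h powr \<alpha>" if "0 < h" for h
  proof -
    have "\<bar>f t\<bar> \<le> \<bar>integral {t..t + h} f\<bar> / h + c * h powr \<alpha>"
    proof (rule Holder_abs_le_integral)
      show "f integrable_on {t..t + h}"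
        using t by (intro integrable_continuous_real continuous_on_subset[OF cont]) auto
      show "\<bar>f x - f t\<bar> \<le> c * \<bar>x - t\<bar> powr \<alpha>" if "x \<in> {t..t + h}" for x
        using that t by (intro assms(5)) auto
    qed (use that assms(2,4) in auto)
    also have "\<dots> \<le> S / h + c * h powr \<alpha>"
      using le_S[of "t + h"] that by (simp add: divide_right_mono)
    finally show ?thesis .
  qed
  have "\<bar>f t\<bar> \<le> (1 + c) * S powr (\<alpha> / (1 + \<alpha>))"
  proof (cases "S = 0")
    \<comment> \<open>Here the balancing \<open>h\<close> would be 0, which \<open>main\<close>
      excludes. Since \<open>0 powr x = 0\<close>, the goal amounts to
      \<open>f t = 0\<close>.\<close>
    case True
    have "((\<lambda>h. h powr \<alpha>) \<longlongrightarrow> 0 powr \<alpha>) (at_right 0)"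
      using assms(2) by (intro tendsto_powr') (auto simp: eventually_at_filter)
    then have "((\<lambda>h. c * h powr \<alpha>) \<longlongrightarrow> 0) (at_right 0)"
      using tendsto_mult_right_zero by force
    moreover have "\<forall>\<^sub>F h in at_right 0. \<bar>f t\<bar> \<le> c * h powr \<alpha>"
      using main True by (auto simp: eventually_at_filter)
    ultimately have "\<bar>f t\<bar> \<le> 0"
      by (rule tendsto_lowerbound) simp
    then show ?thesis
      using True by simp
  next
    case False
    \<comment> \<open>This solves \<open>S / h = h powr \<alpha>\<close>. Both terms then carry the
      same power of \<open>S\<close>, with coefficients 1 and \<open>c\<close>, whence the factor
      \<open>1 + c\<close>.\<close>
    define h where "h = S powr (1 / (1 + \<alpha>))"
    have "h > 0"
      using False \<open>0 \<le> S\<close> by (simp add: h_def)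
    have "S / h = S powr (1 - 1 / (1 + \<alpha>))"
      using False \<open>0 \<le> S\<close> by (simp add: h_def powr_diff)
    also have "1 - 1 / (1 + \<alpha>) = \<alpha> / (1 + \<alpha>)"
      using assms(2) by (simp add: field_simps)
    finally have "S / h = S powr (\<alpha> / (1 + \<alpha>))" .
    moreover have "h powr \<alpha> = S powr (\<alpha> / (1 + \<alpha>))"
      by (simp add: h_def powr_powr)
    ultimately show ?thesis
      using main[OF \<open>h > 0\<close>] by (simp add: algebra_simps)
  qed
  then show "\<bar>f t\<bar> \<le> (1 + c) * tail_sup f t powr (\<alpha> / (1 + \<alpha>))"
    by (simp add: S_def)
qed

end
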